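(* Let $P=\{1,\dots,n\}$, $m\in\{1,\dots,n\}$, $\mathcal{X}=\{x\subseteq P:|x|=m\}$, let $X:\Omega\to\mathcal{X}$ be a random variable on a probability space $(\Omega,\mathscr{A},\mathbb{P})$, let $i_0\in P$, let $x^-\subset P\setminus\{i_0\}$ with $|x^-|=m-1$, and put $I=\{\omega: i_0\in X(\omega)\}$, $\mathcal{A}=\{\omega: x^-\subset X(\omega)\}$. Let $x\in X(I\cap\mathcal{A})$. Let $f:\mathcal{X}\to\mathbb{R}^q$ be a function with bounded image, let $\sigma>0$, $\varepsilon\ge 0$, and consider the Gaussian mechanism with output distributions $P_y=N(f(y),\sigma^2 I_q)$, $y\in\mathcal{X}$. For $x'\in X(I^c\cap\mathcal{A})$ let $S^{\delta}_{x,x'}=\{v\in\mathbb{R}^q: |\log(p_x(v)/p_{x'}(v))|>\varepsilon\}$, where $p_y$ is the Lebesgue density of $P_y$, and let $S^{\delta}_x=\bigcup_{x'\in X(I^c\cap\mathcal{A})}S^{\delta}_{x,x'}$. Let $x_1,\dots,x_p$ be an enumeration of the elements $x'\in X(I^c\cap\mathcal{A})$ with $f(x')\ne f(x)$. For $j,k\in\{1,\dots,p\}$ define $\Delta_j=\|f(x)-f(x_j)\|_2$, $\tilde u_j=(f(x)-f(x_j))/\Delta_j$, $\rho_{j,k}=\langle\tilde u_j,\tilde u_k\rangle$, $$t_j^{(1)}=-\frac{\varepsilon\sigma}{\Delta_j}-\frac{\Delta_j}{2\sigma},\qquad t_j^{(2)}=\frac{\varepsilon\sigma}{\Delta_j}-\frac{\Delta_j}{2\sigma}.$$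 For $i\in\{1,\dots,p\}$ let $\Sigma_i^{(1)}=(\rho_{j,k})_{1\le j,k\le i}$, and let $\Sigma_i^{(2)}$ be the matrix obtained from $\Sigma_i^{(1)}$ by changing the sign of all off-diagonal entries in its last row and last column. Then $$P_x(S^{\delta}_x)=\sum_{i=1}^{p}\sum_{j=1}^{2}\Phi\left([t_1^{(1)},t_1^{(2)}],\dots,[t_{i-1}^{(1)},t_{i-1}^{(2)}],(-1)^{j-1}t_i^{(j)};\Sigma_i^{(j)}\right).$$
   Context: For an $i\times i$ positive semidefinite matrix $\Sigma$, real intervals $[a_1,b_1],\dots,[a_{i-1},b_{i-1}]$ and $c\in\mathbb{R}$, $\Phi([a_1,b_1],\dots,[a_{i-1},b_{i-1}],c;\Sigma)$ denotes the probability that $a_l\le Z_l\le b_l$ for $l=1,\dots,i-1$ and $Z_i\le c$, where $(Z_1,\dots,Z_i)$ is a (possibly degenerate) zero-mean multivariate normal vector with covariance matrix $\Sigma$. $X(E)$ denotes the image of $E\subseteq\Omega$ under $X$. $\langle\cdot,\cdot\rangle$ and $\|\cdot\|_2$ are the Euclidean inner product and norm on $\mathbb{R}^q$. *)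

theory Defs
  imports "HOL-Probability.Probability"
begin

text \<open>The law \<open>N(\<mu>, \<sigma>\<^sup>2 I\<^sub>q)\<close> on \<open>\<real>\<^sup>q\<close>, for \<open>\<sigma> > 0\<close>, given by its Lebesgue density.\<close>

definition isotropic_normal_density :: "real ^ 'q \<Rightarrow> real \<Rightarrow> real ^ 'q \<Rightarrow> real" where
  "isotropic_normal_density \<mu> \<sigma> v =
     1 / sqrt (2 * pi * \<sigma>\<^sup>2) ^ CARD('q) * exp (- (norm (v - \<mu>))\<^sup>2 / (2 * \<sigma>\<^sup>2))"

definition isotropic_normal :: "real ^ 'q \<Rightarrow> real \<Rightarrow> (real ^ 'q) measure" where
  "isotropic_normal \<mu> \<sigma> = density lborel (\<lambda>v. ennreal (isotropic_normal_density \<mu> \<sigma> v))"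

definition gaussian_mechanism_density ::
  "('x \<Rightarrow> real ^ 'q) \<Rightarrow> real \<Rightarrow> 'x \<Rightarrow> real ^ 'q \<Rightarrow> real" where
  "gaussian_mechanism_density f \<sigma> y = isotropic_normal_density (f y) \<sigma>"

definition gaussian_mechanism :: "('x \<Rightarrow> real ^ 'q) \<Rightarrow> real \<Rightarrow> 'x \<Rightarrow> (real ^ 'q) measure" where
  "gaussian_mechanism f \<sigma> y = isotropic_normal (f y) \<sigma>"

definition privacy_loss_set ::
  "('x \<Rightarrow> real ^ 'q) \<Rightarrow> real \<Rightarrow> real \<Rightarrow> 'x \<Rightarrow> 'x \<Rightarrow> (real ^ 'q) set" where
  "privacy_loss_set f \<sigma> \<epsilon> x x' =
     {v. \<bar>ln (gaussian_mechanism_density f \<sigma> x v / gaussian_mechanism_density f \<sigma> x' v)\<bar> > \<epsilon>}"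

text \<open>A real random variable is normal, in the possibly degenerate sense, if it has a normal
  density or is almost surely constant (variance zero).\<close>

definition normal_rv :: "'w measure \<Rightarrow> ('w \<Rightarrow> real) \<Rightarrow> bool" where
  "normal_rv M Y \<longleftrightarrow> Y \<in> borel_measurable M \<and>
     ((\<exists>\<mu> s. s > 0 \<and> distributed M lborel Y (\<lambda>y. ennreal (normal_density \<mu> s y))) \<or>
      (\<exists>\<mu>. AE \<omega> in M. Y \<omega> = \<mu>))"

text \<open>\<open>(Z\<^sub>1, \<dots>, Z\<^sub>i)\<close> is a zero-mean, possibly degenerate, multivariate normal vector with
  covariance matrix \<open>\<Sigma>\<close>: all linear combinations are normal, and the first and second moments
  are as prescribed. Since the dimension varies, vectors and matrices are functions of indices
  in \<open>{1..i}\<close>; values at other indices are irrelevant.\<close>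

definition multivariate_normal ::
  "'w measure \<Rightarrow> nat \<Rightarrow> (nat \<Rightarrow> nat \<Rightarrow> real) \<Rightarrow> (nat \<Rightarrow> 'w \<Rightarrow> real) \<Rightarrow> bool" where
  "multivariate_normal M i \<Sigma> Z \<longleftrightarrow>
     prob_space M \<and>
     (\<forall>l\<in>{1..i}. Z l \<in> borel_measurable M) \<and>
     (\<forall>a :: nat \<Rightarrow> real. normal_rv M (\<lambda>\<omega>. \<Sum>l=1..i. a l * Z l \<omega>)) \<and>
     (\<forall>l\<in>{1..i}. (\<integral>\<omega>. Z l \<omega> \<partial>M) = 0) \<and>
     (\<forall>l\<in>{1..i}. \<forall>k\<in>{1..i}. (\<integral>\<omega>. Z l \<omega> * Z k \<omega> \<partial>M) = \<Sigma> l k)"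

text \<open>The joint law of such a vector. It exists if and only if \<open>\<Sigma>\<close> (restricted to
  \<open>{1..i}\<close>) is symmetric positive semidefinite, and it is then unique.\<close>

definition multivariate_normal_law :: "nat \<Rightarrow> (nat \<Rightarrow> nat \<Rightarrow> real) \<Rightarrow> (nat \<Rightarrow> real) measure" where
  "multivariate_normal_law i \<Sigma> =
     (THE N. sets N = sets (\<Pi>\<^sub>M l\<in>{1..i}. (borel :: real measure)) \<and>
             multivariate_normal N i \<Sigma> (\<lambda>l z. z l))"

text \<open>\<open>\<Phi>([a\<^sub>1,b\<^sub>1], \<dots>, [a\<^sub>i\<^sub>-\<^sub>1,b\<^sub>i\<^sub>-\<^sub>1], c; \<Sigma>)\<close> for an \<open>i \<times> i\<close> matrix \<open>\<Sigma>\<close>.\<close>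

definition Phi ::
  "nat \<Rightarrow> (nat \<Rightarrow> real) \<Rightarrow> (nat \<Rightarrow> real) \<Rightarrow> real \<Rightarrow> (nat \<Rightarrow> nat \<Rightarrow> real) \<Rightarrow> real" where
  "Phi i a b c \<Sigma> =
     measure (multivariate_normal_law i \<Sigma>)
       {z \<in> space (multivariate_normal_law i \<Sigma>).
          (\<forall>l\<in>{1..<i}. a l \<le> z l \<and> z l \<le> b l) \<and> z i \<le> c}"

end

(*  Under N(f(x), sigma^2 I) the standardized variables Y_j = <u_j, v - f(x)> / sigma are jointly
    normal with covariances rho_jk, and the log density ratio at x_j is affine in Y_j, so
    S is the event that some Y_j leaves [t_j^(1), t_j^(2)].  Decomposing by the first such index i
    and by the side on which Y_i leaves gives the two terms; for j = 2 the sign of Y_i is flipped.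

    Phi refers to the normal law through THE, so uniqueness of that law is needed.  A law on R^i is
    determined by its one-dimensional projections (Cramer-Wold): weighting the law by
    2 + g >= 1 for a bounded function g of the other coordinates turns the one-dimensional
    Levy uniqueness theorem into a device that replaces, one coordinate after the other, the
    trigonometric functions cos(<a, z> + s) by indicators of boxes. *)

theory Submission
  imports Defs
begin

section \<open>Uniqueness of laws on finite products of the real line\<close>

text \<open>Dividing \<open>h\<close> by its integral gives a probability density, and the
  hypothesis says that the law of \<open>Y\<close> under the reweighted measures has the same
  characteristic function; Levy uniqueness then gives equal laws. The lower bound 1 on
  \<open>h\<close> keeps the normalizing constant positive, and the upper bound \<open>K\<close>
  makes \<open>h\<close> integrable.\<close>

lemma integral_indicator_eqI_cos:
  fixes h Y :: "'a \<Rightarrow> real"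
  assumes "prob_space N\<^sub>1" "prob_space N\<^sub>2" and sets_eq: "sets N\<^sub>2 = sets N\<^sub>1"
    and Y [measurable]: "Y \<in> borel_measurable N\<^sub>1"
    and h [measurable]: "h \<in> borel_measurable N\<^sub>1"
    and h1: "\<And>\<omega>. 1 \<le> h \<omega>" and hK: "\<And>\<omega>. h \<omega> \<le> K"
    and eq: "\<And>\<theta> s. (\<integral>\<omega>. h \<omega> * cos (\<theta> * Y \<omega> + s) \<partial>N\<^sub>1) = (\<integral>\<omega>. h \<omega> * cos (\<theta> * Y \<omega> + s) \<partial>N\<^sub>2)"
    and B [measurable]: "B \<in> sets borel"
  shows "(\<integral>\<omega>. h \<omega> * indicator B (Y \<omega>) \<partial>N\<^sub>1) = (\<integral>\<omega>. h \<omega> * indicator B (Y \<omega>) \<partial>N\<^sub>2)"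
proof -
  define c where "c = (\<integral>\<omega>. h \<omega> \<partial>N\<^sub>1)"
  define L where "L N = distr (density N (\<lambda>\<omega>. ennreal (h \<omega> / c))) borel Y" for N :: "'a measure"
  \<comment> \<open>Frequency and phase 0 turn the cosine into 1, so both measures have the same
    normalizing constant.\<close>
  have c2: "c = (\<integral>\<omega>. h \<omega> \<partial>N\<^sub>2)"
    using eq[of 0 0] by (simp add: c_def)
  have "prob_space N \<and> sets N = sets N\<^sub>1 \<and> (\<integral>\<omega>. h \<omega> \<partial>N) = c"
    if "N \<in> {N\<^sub>1, N\<^sub>2}" for N
    using that assms(1-3) c_def c2 by auto
  note N = this
  have main: "real_distribution (L N) \<and> c > 0 \<and>
      (\<forall>g :: real \<Rightarrow> real. g \<in> borel_measurable borel \<longrightarrow>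
         (\<integral>x. g x \<partial>L N) = (\<integral>\<omega>. h \<omega> * g (Y \<omega>) \<partial>N) / c)"
    if "N \<in> {N\<^sub>1, N\<^sub>2}" for N
  proof -
    interpret prob_space N using N[OF that] by simp
    have [measurable_cong]: "sets N = sets N\<^sub>1" using N[OF that] by simp
    have int: "integrable N h"
    proof (rule integrable_const_bound[of _ K])
      have "\<bar>h \<omega>\<bar> \<le> K" for \<omega> using h1[of \<omega>] hK[of \<omega>] by linarith
      then show "AE \<omega> in N. norm (h \<omega>) \<le> K" by simp
    qed measurable
    have c: "c = (\<integral>\<omega>. h \<omega> \<partial>N)" using N[OF that] by simp
    have "1 \<le> (\<integral>\<omega>. h \<omega> \<partial>N)"
      using integral_mono[of N "\<lambda>_. 1" h] int h1 by (simp add: prob_space)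
    then have c1: "c > 0" using c by simp
    have nn: "0 \<le> h \<omega> / c" for \<omega>
      using h1[of \<omega>] c1 by simp
    have "emeasure (density N (\<lambda>\<omega>. ennreal (h \<omega> / c))) (space N) = (\<integral>\<^sup>+\<omega>. ennreal (h \<omega> / c) \<partial>N)"
      by (subst emeasure_density) (auto intro!: nn_integral_cong)
    also have "\<dots> = ennreal (\<integral>\<omega>. h \<omega> / c \<partial>N)"
      by (rule nn_integral_eq_integral) (use int nn in auto)
    also have "\<dots> = 1" using c c1 by simp
    finally have p: "prob_space (density N (\<lambda>\<omega>. ennreal (h \<omega> / c)))"
      by (intro prob_spaceI) simp
    have "real_distribution (L N)"
      unfolding real_distribution_def real_distribution_axioms_def L_def
      by (auto intro!: prob_space.prob_space_distr p)
    moreover have "(\<integral>x. g x \<partial>L N) = (\<integral>\<omega>. h \<omega> * g (Y \<omega>) \<partial>N) / c"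
      if [measurable]: "g \<in> borel_measurable borel" for g :: "real \<Rightarrow> real"
      unfolding L_def using nn
      by (simp add: integral_distr integral_density)
    ultimately show ?thesis using c1 by blast
  qed
  have ind: "(\<integral>x. g x \<partial>L N) = (\<integral>\<omega>. h \<omega> * g (Y \<omega>) \<partial>N) / c"
    if "N \<in> {N\<^sub>1, N\<^sub>2}" "g \<in> borel_measurable borel" for N and g :: "real \<Rightarrow> real"
    using main[OF that(1)] that(2) by blast
  have rd: "real_distribution (L N)" if "N \<in> {N\<^sub>1, N\<^sub>2}" for N using main[OF that] by simp
  have c: "c > 0" using main[of N\<^sub>1] by simp
  have coseq: "(\<integral>x. cos (\<theta> * x + s) \<partial>L N\<^sub>1) = (\<integral>x. cos (\<theta> * x + s) \<partial>L N\<^sub>2)" for \<theta> s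
    using ind[of N\<^sub>1 "\<lambda>x. cos (\<theta> * x + s)"] ind[of N\<^sub>2 "\<lambda>x. cos (\<theta> * x + s)"] eq by simp
  \<comment> \<open>The phase -pi/2 turns the cosine into a sine; this is why the hypothesis carries
    a free phase \<open>s\<close>.\<close>
  have sineq: "(\<integral>x. sin (\<theta> * x) \<partial>L N\<^sub>1) = (\<integral>x. sin (\<theta> * x) \<partial>L N\<^sub>2)" for \<theta>
    using coseq[of \<theta> "- (pi / 2)"] by (simp add: cos_diff)
  have "char (L N\<^sub>1) = char (L N\<^sub>2)"
  proof
    fix \<theta>
    have 1: "Re (char (L N) \<theta>) = (\<integral>x. cos (\<theta> * x) \<partial>L N)" "Im (char (L N) \<theta>) = (\<integral>x. sin (\<theta> * x) \<partial>L N)"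
      if "N \<in> {N\<^sub>1, N\<^sub>2}" for N
    proof -
      interpret real_distribution "L N" by (rule rd[OF that])
      have "integrable (L N) (\<lambda>x. iexp (\<theta> * x))"
        by (rule integrable_iexp) auto
      from integral_Re[OF this] integral_Im[OF this]
      show "Re (char (L N) \<theta>) = (\<integral>x. cos (\<theta> * x) \<partial>L N)" "Im (char (L N) \<theta>) = (\<integral>x. sin (\<theta> * x) \<partial>L N)"
        by (simp_all add: char_def Re_exp Im_exp)
    qed
    show "char (L N\<^sub>1) \<theta> = char (L N\<^sub>2) \<theta>"
      using coseq[of \<theta> 0] sineq[of \<theta>] by (auto simp: complex_eq_iff 1)
  qed
  then have "L N\<^sub>1 = L N\<^sub>2"
    by (intro Levy_uniqueness rd) auto
  then show ?thesis
    using ind[of N\<^sub>1 "indicator B"] ind[of N\<^sub>2 "indicator B"] c by simp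
qed

text \<open>Induction on \<open>J\<close>: each step moves one coordinate out of the cosine and into
  the product of indicators. The empty set is the hypothesis \<open>eq\<close>; at
  \<open>J = I\<close> and \<open>s = 0\<close> only the probability of a box remains.\<close>

lemma integral_prod_indicator_eqI_cos:
  fixes Y :: "'i \<Rightarrow> 'a \<Rightarrow> real"
  assumes "prob_space N\<^sub>1" "prob_space N\<^sub>2" and sets_eq: "sets N\<^sub>2 = sets N\<^sub>1"
    and fin: "finite I" and Y [measurable]: "\<And>i. i \<in> I \<Longrightarrow> Y i \<in> borel_measurable N\<^sub>1"
    and eq: "\<And>a s. (\<integral>\<omega>. cos ((\<Sum>i\<in>I. a i * Y i \<omega>) + s) \<partial>N\<^sub>1) = (\<integral>\<omega>. cos ((\<Sum>i\<in>I. a i * Y i \<omega>) + s) \<partial>N\<^sub>2)"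
    and J: "J \<subseteq> I" and B: "\<And>i. i \<in> I \<Longrightarrow> B i \<in> sets borel"
  shows "(\<integral>\<omega>. (\<Prod>i\<in>J. indicator (B i) (Y i \<omega>)) * cos ((\<Sum>i\<in>I - J. a i * Y i \<omega>) + s) \<partial>N\<^sub>1) =
         (\<integral>\<omega>. (\<Prod>i\<in>J. indicator (B i) (Y i \<omega>)) * cos ((\<Sum>i\<in>I - J. a i * Y i \<omega>) + s) \<partial>N\<^sub>2)"
  using finite_subset[OF J fin] J
proof (induction J arbitrary: a s rule: finite_induct)
  case empty
  then show ?case using eq by simp
next
  case (insert j J)
  interpret N1: prob_space N\<^sub>1 by fact
  interpret N2: prob_space N\<^sub>2 by fact
  note [measurable_cong] = sets_eq
  have j: "j \<in> I" "j \<notin> J" and JI: "J \<subseteq> I" using insert by auto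
  note [measurable] = B[OF j(1)] Y[OF j(1)]
  define W where "W \<omega> = (\<Prod>i\<in>J. indicator (B i) (Y i \<omega>) :: real)" for \<omega>
  define \<phi> where "\<phi> \<omega> = (\<Sum>i\<in>I - insert j J. a i * Y i \<omega>)" for \<omega>
  have W [measurable]: "W \<in> borel_measurable N\<^sub>1"
    unfolding W_def using JI B by (intro borel_measurable_prod) (auto intro!: measurable_compose[OF Y])
  have \<phi> [measurable]: "\<phi> \<in> borel_measurable N\<^sub>1"
    unfolding \<phi>_def by measurable
  have W1: "\<bar>W \<omega>\<bar> \<le> 1" for \<omega>
    unfolding W_def abs_prod by (intro prod_le_1) (auto simp: indicator_def)
  have Wc: "\<bar>W \<omega> * cos x\<bar> \<le> 1" for \<omega> x
    unfolding abs_mult using W1 by (intro mult_le_one) auto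
  \<comment> \<open>The induction hypothesis is used with the coefficient of \<open>Y j\<close>
    replaced by an arbitrary frequency, which is why \<open>a\<close> and \<open>s\<close> are kept
    arbitrary in the induction.\<close>
  have sum_upd: "(\<Sum>i\<in>I - J. (a(j := \<theta>)) i * Y i \<omega>) = \<phi> \<omega> + \<theta> * Y j \<omega>" for \<theta> \<omega>
  proof -
    have IJ: "I - J = insert j (I - insert j J)" using j by auto
    have "(\<Sum>i\<in>I - insert j J. (a(j := \<theta>)) i * Y i \<omega>) = \<phi> \<omega>"
      unfolding \<phi>_def by (rule sum.cong) auto
    then show ?thesis
      by (subst IJ, subst sum.insert) (use fin in auto)
  qed
  have IH: "(\<integral>\<omega>. W \<omega> * cos (\<phi> \<omega> + \<theta> * Y j \<omega> + s) \<partial>N\<^sub>1) = (\<integral>\<omega>. W \<omega> * cos (\<phi> \<omega> + \<theta> * Y j \<omega> + s) \<partial>N\<^sub>2)" for \<theta> s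
    using insert.IH[OF JI, of "a(j := \<theta>)" s] unfolding sum_upd W_def[symmetric] .
  have int: "integrable N\<^sub>1 (\<lambda>\<omega>. W \<omega> * cos (\<phi> \<omega> + \<theta> * Y j \<omega> + s))"
       "integrable N\<^sub>2 (\<lambda>\<omega>. W \<omega> * cos (\<phi> \<omega> + \<theta> * Y j \<omega> + s))" for \<theta> s
    by (rule N1.integrable_const_bound[of _ 1] N2.integrable_const_bound[of _ 1]; use Wc in simp)+
  \<comment> \<open>The product-to-sum formula writes the integrand required by the preceding lemma
    as two integrands of the form in \<open>IH\<close>, with frequencies of opposite sign and
    shifted phases.\<close>
  have prod_cos: "W \<omega> * cos (\<phi> \<omega> + s) * cos (\<theta> * Y j \<omega> + r) =
      (W \<omega> * cos (\<phi> \<omega> + (- \<theta>) * Y j \<omega> + (s - r)) + W \<omega> * cos (\<phi> \<omega> + \<theta> * Y j \<omega> + (s + r))) / 2" for \<omega> \<theta> r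
  proof -
    have "\<phi> \<omega> + (- \<theta>) * Y j \<omega> + (s - r) = (\<phi> \<omega> + s) - (\<theta> * Y j \<omega> + r)"
         "\<phi> \<omega> + \<theta> * Y j \<omega> + (s + r) = (\<phi> \<omega> + s) + (\<theta> * Y j \<omega> + r)"
      by simp_all
    then show ?thesis
      by (simp only: cos_diff[of "\<phi> \<omega> + s" "\<theta> * Y j \<omega> + r"] cos_add[of "\<phi> \<omega> + s" "\<theta> * Y j \<omega> + r"])
        (simp add: field_simps)
  qed
  have eq1: "(\<integral>\<omega>. W \<omega> * cos (\<phi> \<omega> + s) * cos (\<theta> * Y j \<omega> + r) \<partial>N\<^sub>1) =
      (\<integral>\<omega>. W \<omega> * cos (\<phi> \<omega> + s) * cos (\<theta> * Y j \<omega> + r) \<partial>N\<^sub>2)" for \<theta> r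
    unfolding prod_cos by (simp only: integral_divide_zero Bochner_Integration.integral_add[OF int(1) int(1)]
        Bochner_Integration.integral_add[OF int(2) int(2)] IH)
  \<comment> \<open>Coefficients concentrated at \<open>j\<close> reduce \<open>eq\<close> to a
    statement about \<open>Y j\<close> alone; it handles the constant part of the weight
    below.\<close>
  have eq0: "(\<integral>\<omega>. cos (\<theta> * Y j \<omega> + r) \<partial>N\<^sub>1) = (\<integral>\<omega>. cos (\<theta> * Y j \<omega> + r) \<partial>N\<^sub>2)" for \<theta> r
  proof -
    have "(\<Sum>i\<in>I. (if i = j then \<theta> else 0) * Y i \<omega>) = \<theta> * Y j \<omega>" for \<omega>
      using j fin by (simp add: if_distrib[of "\<lambda>x. x * _"] cong: if_cong)
    then show ?thesis using eq[of "\<lambda>i. if i = j then \<theta> else 0" r] by simp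
  qed
  have int': "integrable N\<^sub>1 (\<lambda>\<omega>. g \<omega>)" "integrable N\<^sub>2 (\<lambda>\<omega>. g \<omega>)"
    if "g \<in> borel_measurable N\<^sub>1" "\<And>\<omega>. \<bar>g \<omega>\<bar> \<le> 1" for g :: "'a \<Rightarrow> real"
    by (rule N1.integrable_const_bound[of _ 1] N2.integrable_const_bound[of _ 1]; use that in simp)+
  have b: "\<bar>W \<omega> * cos (\<phi> \<omega> + s) * indicator (B j) (Y j \<omega>)\<bar> \<le> 1"
      "\<bar>W \<omega> * cos (\<phi> \<omega> + s) * cos (\<theta> * Y j \<omega> + r)\<bar> \<le> 1" for \<omega> \<theta> r
    by (auto simp: indicator_def Wc abs_mult[of _ "cos (\<theta> * Y j \<omega> + r)"] intro!: mult_le_one)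
  \<comment> \<open>The weight \<open>W \<omega> * cos (\<phi> \<omega> + s)\<close> may be
    negative, but it lies in [-1, 1]. Adding 2 moves it into [1, 3], where the preceding lemma
    applies.\<close>
  have 2: "(\<integral>\<omega>. (2 + W \<omega> * cos (\<phi> \<omega> + s)) * indicator (B j) (Y j \<omega>) \<partial>N\<^sub>1) =
        (\<integral>\<omega>. (2 + W \<omega> * cos (\<phi> \<omega> + s)) * indicator (B j) (Y j \<omega>) \<partial>N\<^sub>2)"
  proof (rule integral_indicator_eqI_cos[where K = 3])
    fix \<omega>
    show "1 \<le> 2 + W \<omega> * cos (\<phi> \<omega> + s)" "2 + W \<omega> * cos (\<phi> \<omega> + s) \<le> 3"
      using Wc[of \<omega> "\<phi> \<omega> + s"] by linarith+
  next
    fix \<theta> r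
    show "(\<integral>\<omega>. (2 + W \<omega> * cos (\<phi> \<omega> + s)) * cos (\<theta> * Y j \<omega> + r) \<partial>N\<^sub>1) =
        (\<integral>\<omega>. (2 + W \<omega> * cos (\<phi> \<omega> + s)) * cos (\<theta> * Y j \<omega> + r) \<partial>N\<^sub>2)"
      unfolding distrib_right using b
      by (subst (1 2) Bochner_Integration.integral_add) (auto intro!: int' simp: eq0 eq1)
  qed (use assms in auto)
  \<comment> \<open>The same lemma with constant weight 1 allows the added constant 2 to be
    subtracted again.\<close>
  have 1: "(\<integral>\<omega>. indicat_real (B j) (Y j \<omega>) \<partial>N\<^sub>1) = (\<integral>\<omega>. indicat_real (B j) (Y j \<omega>) \<partial>N\<^sub>2)"
    using integral_indicator_eqI_cos[where h = "\<lambda>_. 1" and K = 1, OF assms(1-3) Y[OF j(1)], of "B j"] eq0 by simp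
  have "(\<integral>\<omega>. W \<omega> * cos (\<phi> \<omega> + s) * indicator (B j) (Y j \<omega>) \<partial>N\<^sub>1) =
        (\<integral>\<omega>. W \<omega> * cos (\<phi> \<omega> + s) * indicator (B j) (Y j \<omega>) \<partial>N\<^sub>2)"
    using 2 unfolding distrib_right using b
    by (subst (asm) (1 2) Bochner_Integration.integral_add) (auto intro!: int' simp: 1)
  then show ?case
    unfolding \<phi>_def[symmetric] using j insert.hyps by (simp add: W_def[symmetric] mult_ac)
qed

text \<open>The Cramer-Wold theorem. Equal projections give equal integrals of all cosines of affine
  forms, hence equal probabilities of all boxes by the preceding lemma with \<open>J = I\<close>,
  and boxes determine a finite measure on the product.\<close>

lemma PiM_borel_eqI_linear_distr:
  fixes N\<^sub>1 N\<^sub>2 :: "('i \<Rightarrow> real) measure"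
  assumes "prob_space N\<^sub>1" "prob_space N\<^sub>2" and fin: "finite I"
    and s1: "sets N\<^sub>1 = sets (\<Pi>\<^sub>M i\<in>I. borel)" and s2: "sets N\<^sub>2 = sets (\<Pi>\<^sub>M i\<in>I. borel)"
    and eq: "\<And>a. distr N\<^sub>1 borel (\<lambda>z. \<Sum>i\<in>I. a i * z i) = distr N\<^sub>2 borel (\<lambda>z. \<Sum>i\<in>I. a i * z i)"
  shows "N\<^sub>1 = N\<^sub>2"
proof -
  interpret N1: prob_space N\<^sub>1 by fact
  interpret N2: prob_space N\<^sub>2 by fact
  note [measurable_cong] = s1 s2
  have cos_eq: "(\<integral>z. cos ((\<Sum>i\<in>I. a i * z i) + s) \<partial>N\<^sub>1) = (\<integral>z. cos ((\<Sum>i\<in>I. a i * z i) + s) \<partial>N\<^sub>2)" for a s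
  proof -
    have "(\<integral>y. cos (y + s) \<partial>distr N\<^sub>1 borel (\<lambda>z. \<Sum>i\<in>I. a i * z i)) =
          (\<integral>y. cos (y + s) \<partial>distr N\<^sub>2 borel (\<lambda>z. \<Sum>i\<in>I. a i * z i))"
      by (simp only: eq)
    then show ?thesis
      by (subst (asm) (1 2) integral_distr) measurable
  qed
  show ?thesis
  proof (rule measure_eqI_PiM_finite[OF fin s1 s2])
    fix B assume B: "\<And>i. i \<in> I \<Longrightarrow> B i \<in> sets (borel :: real measure)"
    have P: "Pi\<^sub>E I B \<in> sets (\<Pi>\<^sub>M i\<in>I. borel)"
      using B fin by (intro sets_PiM_I_finite)
    have 1: "(\<Prod>i\<in>I. indicator (B i) (z i)) = indicat_real (Pi\<^sub>E I B) z"
      if "z \<in> space (\<Pi>\<^sub>M i\<in>I. borel)" for z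
      using that fin by (auto simp: space_PiM indicator_def PiE_def Pi_def split: if_splits)
    have 2: "(\<integral>z. (\<Prod>i\<in>I. indicator (B i) (z i)) \<partial>N) = measure N (Pi\<^sub>E I B)"
      if "sets N = sets (\<Pi>\<^sub>M i\<in>I. borel)" for N
    proof -
      have "(\<integral>z. (\<Prod>i\<in>I. indicator (B i) (z i)) \<partial>N) = (\<integral>z. indicat_real (Pi\<^sub>E I B) z \<partial>N)"
        using 1 sets_eq_imp_space_eq[OF that] by (intro Bochner_Integration.integral_cong) auto
      also have "\<dots> = measure N (Pi\<^sub>E I B)"
        using sets.sets_into_space[OF P] sets_eq_imp_space_eq[OF that] by (simp add: Int_absorb2)
      finally show ?thesis .
    qed
    have "(\<integral>z. (\<Prod>i\<in>I. indicator (B i) (z i)) * cos ((\<Sum>i\<in>I - I. 0 * z i) + 0) \<partial>N\<^sub>1) =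
          (\<integral>z. (\<Prod>i\<in>I. indicator (B i) (z i)) * cos ((\<Sum>i\<in>I - I. 0 * z i) + 0) \<partial>N\<^sub>2)"
      by (rule integral_prod_indicator_eqI_cos[where Y = "\<lambda>i z. z i"]) (use assms B cos_eq in auto)
    then show "emeasure N\<^sub>1 (Pi\<^sub>E I B) = emeasure N\<^sub>2 (Pi\<^sub>E I B)"
      by (simp add: N1.emeasure_eq_measure N2.emeasure_eq_measure 2 s1 s2)
  next
    \<comment> \<open>The whole space is itself a box of finite measure, so a constant sequence
      serves as the exhausting sequence.\<close>
    show "range (\<lambda>_::nat. space (\<Pi>\<^sub>M i\<in>I. (borel :: real measure))) \<subseteq> prod_algebra I (\<lambda>_. borel)"
      using prod_algebraI_finite[OF fin, of "\<lambda>_. UNIV" "\<lambda>_. borel :: real measure"] by (auto simp: space_PiM)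
  qed auto
qed

section \<open>Centered normal variables and uniqueness of the multivariate normal law\<close>

lemma normal_rv_moments:
  assumes "prob_space M" "normal_rv M Y"
  shows "integrable M Y" "integrable M (\<lambda>\<omega>. (Y \<omega>)\<^sup>2)"
proof -
  interpret prob_space M by fact
  have Y [measurable]: "Y \<in> borel_measurable M" using assms by (simp add: normal_rv_def)
  have "integrable M Y \<and> integrable M (\<lambda>\<omega>. (Y \<omega>)\<^sup>2)"
    using assms(2)[unfolded normal_rv_def, THEN conjunct2]
  proof (elim disjE exE conjE)
    fix \<mu> s :: real assume s: "s > 0" and D: "distributed M lborel Y (\<lambda>y. ennreal (normal_density \<mu> s y))"
    have 1: "integrable M Y"
      using distributed_integrable_var[OF D] integrable_normal_moment_nz_1[OF s, of \<mu>] by simp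
    have 2: "integrable M (\<lambda>\<omega>. (Y \<omega> - \<mu>)\<^sup>2)"
      using distributed_integrable[OF D, of "\<lambda>y. (y - \<mu>)\<^sup>2"] integrable_normal_moment[OF s, of \<mu> 2] by simp
    have "integrable M (\<lambda>\<omega>. (Y \<omega> - \<mu>)\<^sup>2 + 2 * \<mu> * Y \<omega> - \<mu>\<^sup>2)"
      using 1 2 by simp
    also have "(\<lambda>\<omega>. (Y \<omega> - \<mu>)\<^sup>2 + 2 * \<mu> * Y \<omega> - \<mu>\<^sup>2) = (\<lambda>\<omega>. (Y \<omega>)\<^sup>2)"
      by (auto simp: power2_eq_square algebra_simps)
    finally show ?thesis using 1 by simp
  next
    fix \<mu> assume "AE \<omega> in M. Y \<omega> = \<mu>"
    then have "AE \<omega> in M. norm (Y \<omega>) \<le> \<bar>\<mu>\<bar>" "AE \<omega> in M. norm ((Y \<omega>)\<^sup>2) \<le> \<mu>\<^sup>2"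
      by auto
    then show ?thesis
      by (intro conjI) (rule integrable_const_bound; simp)+
  qed
  then show "integrable M Y" "integrable M (\<lambda>\<omega>. (Y \<omega>)\<^sup>2)" by auto
qed

lemma normal_rv_centered_cases:
  assumes "prob_space M" and Y: "normal_rv M Y" and mean: "(\<integral>\<omega>. Y \<omega> \<partial>M) = 0"
  obtains (density) s where "s > 0" "distributed M lborel Y (\<lambda>y. ennreal (normal_density 0 s y))"
      "(\<integral>\<omega>. (Y \<omega>)\<^sup>2 \<partial>M) = s\<^sup>2"
    | (degenerate) "AE \<omega> in M. Y \<omega> = 0" "(\<integral>\<omega>. (Y \<omega>)\<^sup>2 \<partial>M) = 0"
proof -
  interpret prob_space M by fact
  have [measurable]: "Y \<in> borel_measurable M" using assms by (simp add: normal_rv_def)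
  show ?thesis
    using Y[unfolded normal_rv_def, THEN conjunct2]
  proof (elim disjE exE conjE)
    fix \<mu> s :: real assume s: "s > 0" and D: "distributed M lborel Y (\<lambda>y. ennreal (normal_density \<mu> s y))"
    have \<mu>: "\<mu> = 0"
      using normal_distributed_expectation[OF s D] mean by simp
    have "(\<integral>\<omega>. (Y \<omega>)\<^sup>2 \<partial>M) = s\<^sup>2"
      using normal_distributed_variance[OF s D] mean by simp
    then show ?thesis using density s D \<mu> by simp
  next
    fix \<mu> assume AE: "AE \<omega> in M. Y \<omega> = \<mu>"
    have "(\<integral>\<omega>. Y \<omega> \<partial>M) = (\<integral>\<omega>. \<mu> \<partial>M)"
      using AE by (intro integral_cong_AE) auto
    then have "\<mu> = 0" using mean by (simp add: prob_space)
    moreover from this have "(\<integral>\<omega>. (Y \<omega>)\<^sup>2 \<partial>M) = (\<integral>\<omega>. 0 \<partial>M)"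
      using AE by (intro integral_cong_AE) auto
    ultimately show ?thesis using degenerate AE by simp
  qed
qed

text \<open>The second moment separates the two cases: it is \<open>s\<^sup>2 > 0\<close> if there
  is a density and 0 if the variable is almost surely 0. Hence mixed cases cannot occur, and in the
  density case it determines \<open>s\<close>.\<close>

lemma normal_rv_distr_eqI:
  assumes "prob_space M" "prob_space N" and Y: "normal_rv M Y" and Z: "normal_rv N Z"
    and mean: "(\<integral>\<omega>. Y \<omega> \<partial>M) = 0" "(\<integral>\<omega>. Z \<omega> \<partial>N) = 0"
    and var: "(\<integral>\<omega>. (Y \<omega>)\<^sup>2 \<partial>M) = (\<integral>\<omega>. (Z \<omega>)\<^sup>2 \<partial>N)"
  shows "distr M borel Y = distr N borel Z"
proof -
  interpret M: prob_space M by fact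
  interpret N: prob_space N by fact
  have meas [measurable]: "Y \<in> borel_measurable M" "Z \<in> borel_measurable N"
    using Y Z by (simp_all add: normal_rv_def)
  from assms(1) Y mean(1) show ?thesis
  proof (cases rule: normal_rv_centered_cases)
    case (density s)
    note 1 = this
    from assms(2) Z mean(2) show ?thesis
    proof (cases rule: normal_rv_centered_cases)
      case (density s')
      then have "s' = s" using 1 var by (simp add: power2_eq_iff_nonneg)
      then have "distr M lborel Y = distr N lborel Z"
        using 1 density by (simp add: distributed_distr_eq_density)
      then show ?thesis
        by (simp cong: distr_cong)
    next
      case degenerate
      then show ?thesis using 1 var by simp
    qed
  next
    case degenerate
    note 1 = this
    from assms(2) Z mean(2) show ?thesis
    proof (cases rule: normal_rv_centered_cases)
      case (density s')
      then show ?thesis using 1 var by simp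
    next
      case degenerate
      have "distr M borel Y = distr M borel (\<lambda>_. 0)" "distr N borel Z = distr N borel (\<lambda>_. 0)"
        using 1 degenerate by (intro distr_cong_AE; simp)+
      then show ?thesis by (simp only: M.distr_const[of 0 borel] N.distr_const[of 0 borel] space_borel UNIV_I)
    qed
  qed
qed

text \<open>Supplies the two moments that, together with normality, fix the law of each projection,
  so that Cramer-Wold can be applied. The square is expanded termwise; products of coordinates are
  integrable because they are dominated by the sum of the squares.\<close>

lemma multivariate_normal_linear:
  assumes mn: "multivariate_normal M i \<Sigma> Z"
  shows "(\<integral>\<omega>. (\<Sum>l=1..i. a l * Z l \<omega>) \<partial>M) = 0"
    and "(\<integral>\<omega>. (\<Sum>l=1..i. a l * Z l \<omega>)\<^sup>2 \<partial>M) = (\<Sum>l=1..i. \<Sum>k=1..i. a l * a k * \<Sigma> l k)"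
proof -
  interpret prob_space M using mn by (simp add: multivariate_normal_def)
  have Z [measurable]: "Z l \<in> borel_measurable M" if "l \<in> {1..i}" for l
    using mn that by (simp add: multivariate_normal_def)
  have nrv: "normal_rv M (Z l)" if "l \<in> {1..i}" for l
  proof -
    \<comment> \<open>A single coordinate is the linear combination whose coefficients form a unit
      vector.\<close>
    have "normal_rv M (\<lambda>\<omega>. \<Sum>k=1..i. (if k = l then 1 else 0) * Z k \<omega>)"
      using mn unfolding multivariate_normal_def by (elim conjE) (erule allE)
    also have "(\<lambda>\<omega>. \<Sum>k=1..i. (if k = l then 1 else 0) * Z k \<omega>) = Z l"
      using that by (simp add: if_distrib[of "\<lambda>x. x * _"] cong: if_cong)
    finally show ?thesis .
  qed
  note int = normal_rv_moments[OF prob_space_axioms nrv]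
  have int2: "integrable M (\<lambda>\<omega>. Z l \<omega> * Z k \<omega>)" if "l \<in> {1..i}" "k \<in> {1..i}" for l k
  proof (rule Bochner_Integration.integrable_bound)
    show "integrable M (\<lambda>\<omega>. (Z l \<omega>)\<^sup>2 + (Z k \<omega>)\<^sup>2)" using int(2) that by simp
    have "\<bar>x * y\<bar> \<le> x\<^sup>2 + y\<^sup>2" for x y :: real
      using sum_squares_bound[of "\<bar>x\<bar>" "\<bar>y\<bar>"] by (simp add: abs_mult)
        (use mult_nonneg_nonneg[of "\<bar>x\<bar>" "\<bar>y\<bar>"] in linarith)
    then show "AE \<omega> in M. norm (Z l \<omega> * Z k \<omega>) \<le> norm ((Z l \<omega>)\<^sup>2 + (Z k \<omega>)\<^sup>2)"
      by simp
  qed (use that in measurable)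
  show "(\<integral>\<omega>. (\<Sum>l=1..i. a l * Z l \<omega>) \<partial>M) = 0"
    using mn int(1) by (simp add: multivariate_normal_def)
  have "(\<Sum>l=1..i. a l * Z l \<omega>)\<^sup>2 = (\<Sum>l=1..i. \<Sum>k=1..i. a l * a k * (Z l \<omega> * Z k \<omega>))" for \<omega>
    unfolding power2_eq_square sum_product by (simp add: mult_ac)
  then have "(\<integral>\<omega>. (\<Sum>l=1..i. a l * Z l \<omega>)\<^sup>2 \<partial>M) =
      (\<integral>\<omega>. (\<Sum>l=1..i. \<Sum>k=1..i. a l * a k * (Z l \<omega> * Z k \<omega>)) \<partial>M)"
    by simp
  also have "\<dots> = (\<Sum>l=1..i. \<integral>\<omega>. (\<Sum>k=1..i. a l * a k * (Z l \<omega> * Z k \<omega>)) \<partial>M)"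
    by (intro Bochner_Integration.integral_sum Bochner_Integration.integrable_sum integrable_mult_right int2)
  also have "\<dots> = (\<Sum>l=1..i. \<Sum>k=1..i. \<integral>\<omega>. a l * a k * (Z l \<omega> * Z k \<omega>) \<partial>M)"
    by (intro sum.cong refl Bochner_Integration.integral_sum integrable_mult_right int2)
  also have "\<dots> = (\<Sum>l=1..i. \<Sum>k=1..i. a l * a k * \<Sigma> l k)"
    using mn by (simp add: multivariate_normal_def)
  finally show "(\<integral>\<omega>. (\<Sum>l=1..i. a l * Z l \<omega>)\<^sup>2 \<partial>M) = (\<Sum>l=1..i. \<Sum>k=1..i. a l * a k * \<Sigma> l k)" .
qed

text \<open>Resolves the definite description: any law with the required properties is the only one,
  since all projections of a competitor are centered normal with the same second moment.\<close>

lemma multivariate_normal_law_eqI: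
  assumes sets: "sets N = sets (\<Pi>\<^sub>M l\<in>{1..i}. (borel :: real measure))"
    and mn: "multivariate_normal N i \<Sigma> (\<lambda>l z. z l)"
  shows "multivariate_normal_law i \<Sigma> = N"
  unfolding multivariate_normal_law_def
proof (rule the_equality)
  fix N' assume N': "sets N' = sets (\<Pi>\<^sub>M l\<in>{1..i}. (borel :: real measure)) \<and>
    multivariate_normal N' i \<Sigma> (\<lambda>l z. z l)"
  show "N' = N"
  proof (rule PiM_borel_eqI_linear_distr[where I = "{1..i}"])
    fix a
    show "distr N' borel (\<lambda>z. \<Sum>l=1..i. a l * z l) = distr N borel (\<lambda>z. \<Sum>l=1..i. a l * z l)"
      using N' mn multivariate_normal_linear[OF mn, of a] multivariate_normal_linear[OF N'[THEN conjunct2], of a]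
      by (intro normal_rv_distr_eqI) (simp_all add: multivariate_normal_def)
  qed (use assms N' in \<open>auto simp: multivariate_normal_def\<close>)
qed (use assms in auto)

section \<open>The isotropic normal law: independent coordinates and linear forms\<close>

lemma isotropic_normal_density_eq_prod:
  fixes \<mu> v :: "real ^ 'q"
  shows "isotropic_normal_density \<mu> \<sigma> v = (\<Prod>b\<in>Basis. normal_density (\<mu> \<bullet> b) \<sigma> (v \<bullet> b))"
proof -
  have "(norm (v - \<mu>))\<^sup>2 = (\<Sum>b\<in>Basis. (v \<bullet> b - \<mu> \<bullet> b)\<^sup>2)"
    using euclidean_inner[of "v - \<mu>" "v - \<mu>"]
    by (simp only: power2_norm_eq_inner) (simp add: inner_diff_left power2_eq_square)
  then have "- (norm (v - \<mu>))\<^sup>2 / (2 * \<sigma>\<^sup>2) = (\<Sum>b\<in>Basis. - (v \<bullet> b - \<mu> \<bullet> b)\<^sup>2 / (2 * \<sigma>\<^sup>2))"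
    by (simp only: sum_negf[symmetric] sum_divide_distrib)
  then have "exp (- (norm (v - \<mu>))\<^sup>2 / (2 * \<sigma>\<^sup>2)) = (\<Prod>b\<in>Basis. exp (- (v \<bullet> b - \<mu> \<bullet> b)\<^sup>2 / (2 * \<sigma>\<^sup>2)))"
    by (simp only: exp_sum[OF finite_Basis])
  then show ?thesis
    by (simp only: isotropic_normal_density_def normal_density_def prod.distrib prod_constant power_one_over DIM_cart DIM_real mult_1_right)
qed

lemma sets_isotropic_normal [simp, measurable_cong]: "sets (isotropic_normal \<mu> \<sigma>) = sets borel"
  and space_isotropic_normal [simp]: "space (isotropic_normal \<mu> \<sigma>) = UNIV"
  by (simp_all add: isotropic_normal_def)

text \<open>The density is a product over the coordinates, so by Fubini the measure of a box is a
  product of one-dimensional measures. Both the marginals and the independence of the coordinates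
  come from this formula.\<close>

lemma emeasure_isotropic_normal_box:
  fixes \<mu> :: "real ^ 'q"
  assumes A: "\<And>b. b \<in> Basis \<Longrightarrow> A b \<in> sets borel"
  shows "emeasure (isotropic_normal \<mu> \<sigma>) {v. \<forall>b\<in>Basis. v \<bullet> b \<in> A b} =
    (\<Prod>b\<in>Basis. emeasure (density lborel (\<lambda>y. ennreal (normal_density (\<mu> \<bullet> b) \<sigma> y))) (A b))"
proof -
  have box: "{v :: real ^ 'q. \<forall>b\<in>Basis. v \<bullet> b \<in> A b} \<in> sets borel"
  proof -
    have "{v :: real ^ 'q. \<forall>b\<in>Basis. v \<bullet> b \<in> A b} = (\<Inter>b\<in>Basis. (\<lambda>v. v \<bullet> b) -` A b \<inter> space borel)"
      by auto
    also have "\<dots> \<in> sets borel"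
      using A by (intro sets.finite_INT measurable_sets[of _ borel borel]) auto
    finally show ?thesis .
  qed
  have [measurable]: "(\<lambda>v :: real ^ 'q. isotropic_normal_density \<mu> \<sigma> v) \<in> borel_measurable borel"
    unfolding isotropic_normal_density_def by measurable
  have "emeasure (isotropic_normal \<mu> \<sigma>) {v. \<forall>b\<in>Basis. v \<bullet> b \<in> A b} =
     (\<integral>\<^sup>+v. ennreal (isotropic_normal_density \<mu> \<sigma> v) * indicator {v. \<forall>b\<in>Basis. v \<bullet> b \<in> A b} v \<partial>lborel)"
    unfolding isotropic_normal_def using box by (subst emeasure_density) auto
  also have "\<dots> = (\<integral>\<^sup>+v. (\<Prod>b\<in>Basis. ennreal (normal_density (\<mu> \<bullet> b) \<sigma> (v \<bullet> b)) * indicator (A b) (v \<bullet> b)) \<partial>lborel)"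
    by (intro nn_integral_cong)
      (auto simp: isotropic_normal_density_eq_prod prod.distrib prod_ennreal indicator_def)
  also have "\<dots> = (\<Prod>b\<in>Basis. \<integral>\<^sup>+y. ennreal (normal_density (\<mu> \<bullet> b) \<sigma> y) * indicator (A b) y \<partial>lborel)"
    using A by (intro nn_integral_lborel_prod) auto
  also have "\<dots> = (\<Prod>b\<in>Basis. emeasure (density lborel (\<lambda>y. ennreal (normal_density (\<mu> \<bullet> b) \<sigma> y))) (A b))"
    using A by (intro prod.cong refl, subst emeasure_density) auto
  finally show ?thesis .
qed

lemma emeasure_isotropic_normal_coordinate:
  fixes \<mu> :: "real ^ 'q"
  assumes "\<sigma> > 0" and A: "A \<in> sets borel" and b: "b \<in> Basis"
  shows "emeasure (isotropic_normal \<mu> \<sigma>) {v. v \<bullet> b \<in> A} =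
    emeasure (density lborel (\<lambda>y. ennreal (normal_density (\<mu> \<bullet> b) \<sigma> y))) A"
proof -
  let ?A = "\<lambda>b'. if b' = b then A else UNIV"
  let ?N = "\<lambda>b. density lborel (\<lambda>y. ennreal (normal_density (\<mu> \<bullet> b) \<sigma> y))"
  \<comment> \<open>A condition on one coordinate is a box whose other sides are the whole line;
    those sides contribute factors 1.\<close>
  have "{v. v \<bullet> b \<in> A} = {v :: real ^ 'q. \<forall>b'\<in>Basis. v \<bullet> b' \<in> ?A b'}"
    using b by auto
  then have "emeasure (isotropic_normal \<mu> \<sigma>) {v. v \<bullet> b \<in> A} = (\<Prod>b'\<in>Basis. emeasure (?N b') (?A b'))"
    using A emeasure_isotropic_normal_box[of ?A \<mu> \<sigma>] by simp
  also have "\<dots> = (\<Prod>b'\<in>Basis. if b' = b then emeasure (?N b) A else 1)"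
    using prob_space.emeasure_space_1[OF prob_space_normal_density[OF assms(1)]]
    by (intro prod.cong) auto
  also have "\<dots> = emeasure (?N b) A"
    using b by simp
  finally show ?thesis .
qed

lemma prob_space_isotropic_normal:
  fixes \<mu> :: "real ^ 'q"
  assumes "\<sigma> > 0" shows "prob_space (isotropic_normal \<mu> \<sigma>)"
proof
  obtain b :: "real ^ 'q" where "b \<in> Basis" using nonempty_Basis by blast
  from emeasure_isotropic_normal_coordinate[OF assms _ this, of UNIV \<mu>]
  show "emeasure (isotropic_normal \<mu> \<sigma>) (space (isotropic_normal \<mu> \<sigma>)) = 1"
    using prob_space.emeasure_space_1[OF prob_space_normal_density[OF assms]] by simp
qed

lemma distributed_isotropic_normal_coordinate:
  fixes \<mu> :: "real ^ 'q"
  assumes "\<sigma> > 0" "b \<in> Basis"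
  shows "distributed (isotropic_normal \<mu> \<sigma>) lborel (\<lambda>v. v \<bullet> b) (normal_density (\<mu> \<bullet> b) \<sigma>)"
  unfolding distributed_def
proof (intro conjI measure_eqI)
  fix A assume "A \<in> sets (distr (isotropic_normal \<mu> \<sigma>) lborel (\<lambda>v. v \<bullet> b))"
  then have A: "A \<in> sets borel" by simp
  then show "emeasure (distr (isotropic_normal \<mu> \<sigma>) lborel (\<lambda>v. v \<bullet> b)) A =
      emeasure (density lborel (\<lambda>y. ennreal (normal_density (\<mu> \<bullet> b) \<sigma> y))) A"
    using emeasure_isotropic_normal_coordinate[OF assms(1) A assms(2), of \<mu>]
    by (subst emeasure_distr) (auto simp: vimage_def)
qed auto

lemma indep_vars_isotropic_normal:
  fixes \<mu> :: "real ^ 'q"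
  assumes "\<sigma> > 0"
  shows "prob_space.indep_vars (isotropic_normal \<mu> \<sigma>) (\<lambda>_. borel) (\<lambda>b v. v \<bullet> b) Basis"
proof -
  interpret prob_space "isotropic_normal \<mu> \<sigma>" by (rule prob_space_isotropic_normal[OF assms])
  have "prob (\<Inter>b\<in>Basis. (\<lambda>v. v \<bullet> b) -` A b \<inter> space (isotropic_normal \<mu> \<sigma>)) =
      (\<Prod>b\<in>Basis. prob ((\<lambda>v. v \<bullet> b) -` A b \<inter> space (isotropic_normal \<mu> \<sigma>)))"
    if A: "A \<in> (\<Pi> b\<in>Basis. sets borel)" for A
  proof -
    have eq: "(\<Inter>b\<in>Basis. {v :: real ^ 'q. v \<bullet> b \<in> A b}) = {v. \<forall>b\<in>Basis. v \<bullet> b \<in> A b}"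
      "\<And>b. (\<lambda>v :: real ^ 'q. v \<bullet> b) -` A b = {v. v \<bullet> b \<in> A b}" by auto
    have "ennreal (prob {v. \<forall>b\<in>Basis. v \<bullet> b \<in> A b}) = (\<Prod>b\<in>Basis. ennreal (prob {v. v \<bullet> b \<in> A b}))"
      unfolding emeasure_eq_measure[symmetric] using A
      by (subst emeasure_isotropic_normal_box)
        (auto intro!: prod.cong emeasure_isotropic_normal_coordinate[OF assms, symmetric])
    then show ?thesis
      unfolding space_isotropic_normal Int_UNIV_right eq by (simp add: prod_ennreal prod_nonneg)
  qed
  note box = this
  show ?thesis
  proof (rule iffD2[OF indep_vars_finite[where E = "\<lambda>_. sets borel"]])
    show "sets borel = sigma_sets (space borel) (sets (borel :: real measure))"
      by (rule sets.sigma_sets_eq[symmetric])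
    show "Int_stable (sets (borel :: real measure))" by (rule sets.Int_stable)
    show "\<forall>A\<in>Basis \<rightarrow> sets borel. prob (\<Inter>b\<in>Basis. (\<lambda>v. v \<bullet> b) -` A b \<inter> space (isotropic_normal \<mu> \<sigma>)) =
      (\<Prod>b\<in>Basis. prob ((\<lambda>v. v \<bullet> b) -` A b \<inter> space (isotropic_normal \<mu> \<sigma>)))"
      using box by blast
    show "random_variable borel (\<lambda>v. v \<bullet> b)" for b by measurable
  qed (auto simp: sets.space_closed nonempty_Basis)
qed

text \<open>The linear form is a sum of independent centered normal variables, one for each basis
  vector, so the variances add up to \<open>\<sigma>\<^sup>2 * (norm c)\<^sup>2\<close>.\<close>

lemma distributed_isotropic_normal_inner:
  fixes \<mu> c :: "real ^ 'q"
  assumes \<sigma>: "\<sigma> > 0" and c: "c \<noteq> 0"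
  shows "distributed (isotropic_normal \<mu> \<sigma>) lborel (\<lambda>v. c \<bullet> (v - \<mu>)) (normal_density 0 (\<sigma> * norm c))"
proof -
  interpret prob_space "isotropic_normal \<mu> \<sigma>" by (rule prob_space_isotropic_normal[OF \<sigma>])
  \<comment> \<open>Terms with coefficient 0 have no density and must be dropped before
    \<open>sum_indep_normal\<close> applies; since \<open>c\<close> is nonzero, some term
    remains.\<close>
  define J where "J = {b \<in> Basis. c \<bullet> b \<noteq> 0}"
  have J: "finite J" "J \<subseteq> Basis" by (auto simp: J_def)
  have "J \<noteq> {}" using c euclidean_all_zero_iff[of c] by (auto simp: J_def)
  have indep: "indep_vars (\<lambda>_. borel) (\<lambda>b v. - (c \<bullet> b) * (\<mu> \<bullet> b) + (c \<bullet> b) * (v \<bullet> b)) J"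
    by (rule indep_vars_compose2[OF indep_vars_subset[OF indep_vars_isotropic_normal[OF \<sigma>] J(2)]]) measurable
  have "distributed (isotropic_normal \<mu> \<sigma>) lborel
     (\<lambda>v. \<Sum>b\<in>J. - (c \<bullet> b) * (\<mu> \<bullet> b) + (c \<bullet> b) * (v \<bullet> b))
     (normal_density (\<Sum>b\<in>J. 0) (sqrt (\<Sum>b\<in>J. (\<bar>c \<bullet> b\<bar> * \<sigma>)\<^sup>2)))"
  proof (rule sum_indep_normal[OF J(1) \<open>J \<noteq> {}\<close> indep])
    fix b assume "b \<in> J"
    then have b: "b \<in> Basis" "c \<bullet> b \<noteq> 0" by (auto simp: J_def)
    then show "0 < \<bar>c \<bullet> b\<bar> * \<sigma>" using \<sigma> by simp
    show "distributed (isotropic_normal \<mu> \<sigma>) lborel (\<lambda>v. - (c \<bullet> b) * (\<mu> \<bullet> b) + (c \<bullet> b) * (v \<bullet> b))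
        (normal_density 0 (\<bar>c \<bullet> b\<bar> * \<sigma>))"
      using normal_density_affine[OF distributed_isotropic_normal_coordinate[OF \<sigma> b(1), of \<mu>] \<sigma> b(2), of "- (c \<bullet> b) * (\<mu> \<bullet> b)"]
      by simp
  qed
  moreover have "(\<Sum>b\<in>J. - (c \<bullet> b) * (\<mu> \<bullet> b) + (c \<bullet> b) * (v \<bullet> b)) = c \<bullet> (v - \<mu>)" for v
  proof -
    have "c \<bullet> (v - \<mu>) = (\<Sum>b\<in>Basis. (c \<bullet> b) * ((v - \<mu>) \<bullet> b))" by (rule euclidean_inner)
    also have "\<dots> = (\<Sum>b\<in>J. (c \<bullet> b) * ((v - \<mu>) \<bullet> b))"
      by (rule sum.mono_neutral_right) (auto simp: J_def)
    finally show ?thesis by (simp add: inner_diff_left algebra_simps)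
  qed
  moreover have "sqrt (\<Sum>b\<in>J. (\<bar>c \<bullet> b\<bar> * \<sigma>)\<^sup>2) = \<sigma> * norm c"
  proof -
    have "(\<Sum>b\<in>J. (\<bar>c \<bullet> b\<bar> * \<sigma>)\<^sup>2) = (\<Sum>b\<in>Basis. (\<bar>c \<bullet> b\<bar> * \<sigma>)\<^sup>2)"
      by (rule sum.mono_neutral_left) (auto simp: J_def)
    also have "\<dots> = \<sigma>\<^sup>2 * (c \<bullet> c)"
      unfolding euclidean_inner[of c c] by (simp add: sum_distrib_left power2_eq_square mult_ac)
    finally show ?thesis using \<sigma> by (simp add: real_sqrt_mult norm_eq_sqrt_inner)
  qed
  ultimately show ?thesis by simp
qed

text \<open>Here \<open>c\<close> may be 0, where the degenerate case of \<open>normal_rv\<close>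
  applies. This is needed because a linear combination of nonzero vectors can vanish.\<close>

lemma normal_rv_isotropic_normal_inner:
  fixes \<mu> c :: "real ^ 'q"
  assumes \<sigma>: "\<sigma> > 0"
  shows "normal_rv (isotropic_normal \<mu> \<sigma>) (\<lambda>v. c \<bullet> (v - \<mu>))"
    and "(\<integral>v. c \<bullet> (v - \<mu>) \<partial>isotropic_normal \<mu> \<sigma>) = 0"
    and "(\<integral>v. (c \<bullet> (v - \<mu>))\<^sup>2 \<partial>isotropic_normal \<mu> \<sigma>) = \<sigma>\<^sup>2 * (norm c)\<^sup>2"
proof -
  interpret prob_space "isotropic_normal \<mu> \<sigma>" by (rule prob_space_isotropic_normal[OF \<sigma>])
  have "normal_rv (isotropic_normal \<mu> \<sigma>) (\<lambda>v. c \<bullet> (v - \<mu>)) \<and>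
    (\<integral>v. c \<bullet> (v - \<mu>) \<partial>isotropic_normal \<mu> \<sigma>) = 0 \<and>
    (\<integral>v. (c \<bullet> (v - \<mu>))\<^sup>2 \<partial>isotropic_normal \<mu> \<sigma>) = \<sigma>\<^sup>2 * (norm c)\<^sup>2"
  proof (cases "c = 0")
    case True
    then show ?thesis by (auto simp: normal_rv_def)
  next
    case False
    have pos: "\<sigma> * norm c > 0" using \<sigma> False by simp
    note D = distributed_isotropic_normal_inner[OF \<sigma> False, of \<mu>]
    note E = normal_distributed_expectation[OF pos D]
    show ?thesis
      using E normal_distributed_variance[OF pos D] pos D by (auto simp: normal_rv_def power_mult_distrib)
  qed
  then show "normal_rv (isotropic_normal \<mu> \<sigma>) (\<lambda>v. c \<bullet> (v - \<mu>))"
    "(\<integral>v. c \<bullet> (v - \<mu>) \<partial>isotropic_normal \<mu> \<sigma>) = 0"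
    "(\<integral>v. (c \<bullet> (v - \<mu>))\<^sup>2 \<partial>isotropic_normal \<mu> \<sigma>) = \<sigma>\<^sup>2 * (norm c)\<^sup>2" by auto
qed

text \<open>Polarization reduces the mixed moment to the second moments of the forms given by
  \<open>c + d\<close> and \<open>c - d\<close>.\<close>

lemma integral_isotropic_normal_inner_mult:
  fixes \<mu> c d :: "real ^ 'q"
  assumes \<sigma>: "\<sigma> > 0"
  shows "(\<integral>v. (c \<bullet> (v - \<mu>)) * (d \<bullet> (v - \<mu>)) \<partial>isotropic_normal \<mu> \<sigma>) = \<sigma>\<^sup>2 * (c \<bullet> d)"
proof -
  have pol: "(c \<bullet> w) * (d \<bullet> w) = (((c + d) \<bullet> w)\<^sup>2 - ((c - d) \<bullet> w)\<^sup>2) / 4" for w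
    by (simp only: inner_add_left inner_diff_left) (simp add: power2_sum power2_diff)
  note n = normal_rv_isotropic_normal_inner[OF \<sigma>]
  note int = normal_rv_moments(2)[OF prob_space_isotropic_normal[OF \<sigma>] n(1)]
  have "(\<integral>v. (c \<bullet> (v - \<mu>)) * (d \<bullet> (v - \<mu>)) \<partial>isotropic_normal \<mu> \<sigma>) =
      (\<sigma>\<^sup>2 * (norm (c + d))\<^sup>2 - \<sigma>\<^sup>2 * (norm (c - d))\<^sup>2) / 4"
    unfolding pol by (simp only: integral_divide_zero Bochner_Integration.integral_diff[OF int int] n(3))
  also have "\<dots> = \<sigma>\<^sup>2 * (c \<bullet> d)"
    by (simp add: power2_norm_eq_inner inner_commute[of d c] algebra_simps)
  finally show ?thesis .
qed

section \<open>Values of \<open>Phi\<close> as isotropic normal probabilities\<close>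

text \<open>A Gram matrix is the covariance matrix of the linear forms given by its vectors. The
  image law is therefore a witness for the description in \<open>multivariate_normal_law\<close>,
  even when the vectors are linearly dependent.\<close>

lemma multivariate_normal_law_isotropic_normal:
  fixes \<mu> :: "real ^ 'q" and c :: "nat \<Rightarrow> real ^ 'q"
  assumes \<sigma>: "\<sigma> > 0"
    and \<Sigma>: "\<And>l k. l \<in> {1..i} \<Longrightarrow> k \<in> {1..i} \<Longrightarrow> \<Sigma> l k = c l \<bullet> c k"
  shows "multivariate_normal_law i \<Sigma> =
    distr (isotropic_normal \<mu> \<sigma>) (\<Pi>\<^sub>M l\<in>{1..i}. borel) (\<lambda>v. \<lambda>l\<in>{1..i}. c l \<bullet> (v - \<mu>) / \<sigma>)"
proof (rule multivariate_normal_law_eqI)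
  let ?P = "isotropic_normal \<mu> \<sigma>"
  let ?T = "\<lambda>v. \<lambda>l\<in>{1..i}. c l \<bullet> (v - \<mu>) / \<sigma>"
  let ?D = "distr ?P (\<Pi>\<^sub>M l\<in>{1..i}. (borel :: real measure)) ?T"
  interpret P: prob_space ?P by (rule prob_space_isotropic_normal[OF \<sigma>])
  have T [measurable]: "?T \<in> measurable ?P (\<Pi>\<^sub>M l\<in>{1..i}. borel)"
    by (rule measurable_restrict) measurable
  have proj [measurable]: "(\<lambda>z. z l) \<in> borel_measurable (\<Pi>\<^sub>M l\<in>{1..i}. (borel :: real measure))"
    if "l \<in> {1..i}" for l
    using that by measurable
  show "multivariate_normal ?D i \<Sigma> (\<lambda>l z. z l)"
    unfolding multivariate_normal_def
  proof (intro conjI ballI allI)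
    show "prob_space ?D" by (rule P.prob_space_distr[OF T])
  next
    fix l assume l: "l \<in> {1..i}"
    then show "(\<lambda>z. z l) \<in> borel_measurable ?D" by measurable
    show "(\<integral>z. z l \<partial>?D) = 0"
      using l normal_rv_isotropic_normal_inner(2)[OF \<sigma>, where c = "c l" and \<mu> = \<mu>]
      by (subst integral_distr[OF T proj]) auto
    fix k assume k: "k \<in> {1..i}"
    have "(\<integral>z. z l * z k \<partial>?D) = (\<integral>v. (c l \<bullet> (v - \<mu>)) * (c k \<bullet> (v - \<mu>)) / \<sigma>\<^sup>2 \<partial>?P)"
      using l k by (subst integral_distr[OF T]) (auto simp: power2_eq_square)
    also have "\<dots> = \<Sigma> l k"
      using \<sigma> \<Sigma>[OF l k] by (simp add: integral_isotropic_normal_inner_mult)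
    finally show "(\<integral>z. z l * z k \<partial>?D) = \<Sigma> l k" .
  next
    fix a :: "nat \<Rightarrow> real"
    \<comment> \<open>A linear combination of the forms is again a form, given by the vector
      \<open>d\<close>; the factor \<open>1 / \<sigma>\<close> absorbs the standardization.\<close>
    define d where "d = (\<Sum>l=1..i. (a l / \<sigma>) *\<^sub>R c l)"
    let ?L = "\<lambda>z. \<Sum>l=1..i. a l * z l"
    have L: "?L \<in> borel_measurable (\<Pi>\<^sub>M l\<in>{1..i}. borel)" by measurable
    have LT: "?L (?T v) = d \<bullet> (v - \<mu>)" for v
      unfolding d_def inner_sum_left by (rule sum.cong) auto
    have nrv: "normal_rv ?P (\<lambda>v. ?L (?T v))"
      unfolding LT by (rule normal_rv_isotropic_normal_inner(1)[OF \<sigma>])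
    show "normal_rv ?D ?L"
      using nrv L T unfolding normal_rv_def distributed_def
      by (auto simp: distr_distr comp_def AE_distr_iff)
  qed
qed simp

lemma Phi_eq_measure_isotropic_normal:
  fixes \<mu> :: "real ^ 'q" and c :: "nat \<Rightarrow> real ^ 'q"
  assumes \<sigma>: "\<sigma> > 0" and i: "i \<ge> 1"
    and \<Sigma>: "\<And>l k. l \<in> {1..i} \<Longrightarrow> k \<in> {1..i} \<Longrightarrow> \<Sigma> l k = c l \<bullet> c k"
  shows "Phi i a b r \<Sigma> = measure (isotropic_normal \<mu> \<sigma>)
    {v. (\<forall>l\<in>{1..<i}. a l \<le> c l \<bullet> (v - \<mu>) / \<sigma> \<and> c l \<bullet> (v - \<mu>) / \<sigma> \<le> b l) \<and> c i \<bullet> (v - \<mu>) / \<sigma> \<le> r}"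
proof -
  let ?E = "{z \<in> space (\<Pi>\<^sub>M l\<in>{1..i}. borel). (\<forall>l\<in>{1..<i}. a l \<le> z l \<and> z l \<le> b l) \<and> z i \<le> r}"
  have T: "(\<lambda>v. \<lambda>l\<in>{1..i}. c l \<bullet> (v - \<mu>) / \<sigma>) \<in> measurable (isotropic_normal \<mu> \<sigma>) (\<Pi>\<^sub>M l\<in>{1..i}. borel)"
    by (rule measurable_restrict) measurable
  have proj: "(\<lambda>z. z l) \<in> borel_measurable (\<Pi>\<^sub>M l\<in>{1..i}. (borel :: real measure))" for l
  proof (cases "l \<in> {1..i}")
    \<comment> \<open>Points of the product space are extensional, so a coordinate outside the index
      set is the constant \<open>undefined\<close>. Measurability thus holds for every
      \<open>l\<close>.\<close>
    case False
    have "(\<lambda>z. z l) \<in> borel_measurable (\<Pi>\<^sub>M l\<in>{1..i}. (borel :: real measure)) \<longleftrightarrow>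
        (\<lambda>_. undefined :: real) \<in> borel_measurable (\<Pi>\<^sub>M l\<in>{1..i}. (borel :: real measure))"
      by (intro measurable_cong) (use False in \<open>auto simp: space_PiM PiE_def extensional_def\<close>)
    then show ?thesis by simp
  qed measurable
  have "?E \<in> sets (\<Pi>\<^sub>M l\<in>{1..i}. (borel :: real measure))"
    by (intro sets.sets_Collect_conj sets.sets_Collect_countable_Ball borel_measurable_le borel_measurable_const proj)
  moreover have "multivariate_normal_law i \<Sigma> =
      distr (isotropic_normal \<mu> \<sigma>) (\<Pi>\<^sub>M l\<in>{1..i}. borel) (\<lambda>v. \<lambda>l\<in>{1..i}. c l \<bullet> (v - \<mu>) / \<sigma>)"
    by (rule multivariate_normal_law_isotropic_normal[OF \<sigma> \<Sigma>])
  ultimately show ?thesis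
    unfolding Phi_def
    by (simp only: space_distr, subst measure_distr[OF T]) (use i in \<open>auto simp: space_PiM intro!: arg_cong2[where f = measure]\<close>)
qed

text \<open>The form has a Lebesgue density, so it hits a given value with probability 0. This
  bridges the strict inequalities of the privacy loss set and the weak ones in
  \<open>Phi\<close>.\<close>

lemma AE_isotropic_normal_inner_neq:
  fixes \<mu> c :: "real ^ 'q"
  assumes \<sigma>: "\<sigma> > 0" and c: "c \<noteq> 0"
  shows "AE v in isotropic_normal \<mu> \<sigma>. c \<bullet> (v - \<mu>) / \<sigma> \<noteq> r"
proof -
  note D = distributed_isotropic_normal_inner[OF \<sigma> c, of \<mu>]
  have "AE y in density lborel (\<lambda>y. ennreal (normal_density 0 (\<sigma> * norm c) y)). y \<noteq> r * \<sigma>"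
    using AE_lborel_singleton[of "r * \<sigma>"] by (subst AE_density) (auto elim: eventually_mono)
  then have "AE y in distr (isotropic_normal \<mu> \<sigma>) lborel (\<lambda>v. c \<bullet> (v - \<mu>)). y \<noteq> r * \<sigma>"
    unfolding distributed_distr_eq_density[OF D] .
  then have "AE v in isotropic_normal \<mu> \<sigma>. c \<bullet> (v - \<mu>) \<noteq> r * \<sigma>"
    by (subst (asm) AE_distr_iff) auto
  then show ?thesis
    using \<sigma> by (auto simp: field_simps)
qed

section \<open>Privacy loss sets and decomposition by the first exit\<close>

text \<open>The quadratic terms in \<open>v\<close> cancel in the log density ratio, which becomes
  \<open>(\<Delta> / \<sigma>) * (y v + \<Delta> / (2 * \<sigma>))\<close>. Its absolute value
  exceeds \<epsilon> on two half-lines for \<open>y v\<close>, with the endpoints stated.\<close>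

lemma mem_privacy_loss_set_iff:
  fixes f :: "'x \<Rightarrow> real ^ 'q"
  assumes \<sigma>: "\<sigma> > 0" and ne: "f x' \<noteq> f x"
  defines "\<Delta> \<equiv> norm (f x - f x')"
  defines "y \<equiv> \<lambda>v. ((1 / \<Delta>) *\<^sub>R (f x - f x')) \<bullet> (v - f x) / \<sigma>"
  shows "v \<in> privacy_loss_set f \<sigma> \<epsilon> x x' \<longleftrightarrow>
    y v < - (\<epsilon> * \<sigma> / \<Delta>) - \<Delta> / (2 * \<sigma>) \<or> \<epsilon> * \<sigma> / \<Delta> - \<Delta> / (2 * \<sigma>) < y v"
proof -
  have \<Delta>: "\<Delta> > 0" using ne by (simp add: \<Delta>_def)
  define d w where "d = f x - f x'" and "w = v - f x"
  have "(norm (v - f x'))\<^sup>2 = (norm (w + d))\<^sup>2" by (simp add: d_def w_def)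
  also have "\<dots> = (norm w)\<^sup>2 + 2 * (d \<bullet> w) + \<Delta>\<^sup>2"
    by (simp add: \<Delta>_def d_def[symmetric] power2_norm_eq_inner inner_add_left inner_add_right inner_commute)
  finally have norm_eq: "(norm (v - f x'))\<^sup>2 = (norm (v - f x))\<^sup>2 + 2 * (d \<bullet> w) + \<Delta>\<^sup>2"
    by (simp add: w_def)
  have dw: "d \<bullet> w = y v * \<Delta> * \<sigma>"
    using \<Delta> \<sigma> by (simp add: y_def d_def w_def)
  have "gaussian_mechanism_density f \<sigma> x v / gaussian_mechanism_density f \<sigma> x' v =
      exp (- (norm (v - f x))\<^sup>2 / (2 * \<sigma>\<^sup>2) - - (norm (v - f x'))\<^sup>2 / (2 * \<sigma>\<^sup>2))"
    using \<sigma>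
    by (simp only: exp_diff) (simp add: gaussian_mechanism_density_def isotropic_normal_density_def)
  then have "ln (gaussian_mechanism_density f \<sigma> x v / gaussian_mechanism_density f \<sigma> x' v) =
      (2 * (d \<bullet> w) + \<Delta>\<^sup>2) / (2 * \<sigma>\<^sup>2)"
    by (simp add: norm_eq diff_divide_distrib add_divide_distrib)
  also have "\<dots> = (\<Delta> / \<sigma>) * (y v + \<Delta> / (2 * \<sigma>))"
    unfolding dw using \<sigma> by (simp add: field_simps power2_eq_square)
  finally have "\<bar>ln (gaussian_mechanism_density f \<sigma> x v / gaussian_mechanism_density f \<sigma> x' v)\<bar> =
      (\<Delta> / \<sigma>) * \<bar>y v + \<Delta> / (2 * \<sigma>)\<bar>"
    using \<Delta> \<sigma> by (simp add: abs_mult)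
  then have "v \<in> privacy_loss_set f \<sigma> \<epsilon> x x' \<longleftrightarrow> \<epsilon> < (\<Delta> / \<sigma>) * \<bar>y v + \<Delta> / (2 * \<sigma>)\<bar>"
    by (simp add: privacy_loss_set_def)
  also have "\<dots> \<longleftrightarrow> \<epsilon> * \<sigma> / \<Delta> < \<bar>y v + \<Delta> / (2 * \<sigma>)\<bar>"
    using \<Delta> \<sigma> by (simp add: field_simps)
  finally show ?thesis by linarith
qed

text \<open>The two densities coincide, so the log ratio is 0. This justifies that the enumeration
  omits the \<open>x'\<close> with the same value of \<open>f\<close>.\<close>

lemma privacy_loss_set_empty:
  fixes f :: "'x \<Rightarrow> real ^ 'q"
  assumes "\<sigma> > 0" "\<epsilon> \<ge> 0" "f x' = f x"
  shows "privacy_loss_set f \<sigma> \<epsilon> x x' = {}"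
  using assms
  by (auto simp: privacy_loss_set_def gaussian_mechanism_density_def isotropic_normal_density_def)

text \<open>Each point of the union is counted at the least index whose set contains it, which makes
  the pieces disjoint.\<close>

lemma (in finite_measure) measure_UN_first_entry:
  assumes E: "\<And>i. i \<in> {1..p} \<Longrightarrow> E i \<in> sets M"
  shows "measure M (\<Union>i\<in>{1..p::nat}. E i) = (\<Sum>i=1..p. measure M (E i - (\<Union>l\<in>{1..<i}. E l)))"
proof -
  have "(\<Union>i\<in>{1..p}. E i) = (\<Union>i\<in>{1..p}. E i - (\<Union>l\<in>{1..<i}. E l))"
  proof (intro equalityI subsetI)
    fix v assume "v \<in> (\<Union>i\<in>{1..p}. E i)"
    then have ex: "\<exists>i. i \<in> {1..p} \<and> v \<in> E i" by blast
    define i where "i = (LEAST i. i \<in> {1..p} \<and> v \<in> E i)"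
    have i: "i \<in> {1..p}" "v \<in> E i"
      using LeastI_ex[OF ex] by (auto simp: i_def)
    have "v \<notin> E l" if "l \<in> {1..<i}" for l
      using not_less_Least[of l "\<lambda>i. i \<in> {1..p} \<and> v \<in> E i"] that i unfolding i_def[symmetric] by auto
    then show "v \<in> (\<Union>i\<in>{1..p}. E i - (\<Union>l\<in>{1..<i}. E l))" using i by blast
  qed auto
  moreover have "disjoint_family_on (\<lambda>i. E i - (\<Union>l\<in>{1..<i}. E l)) {1..p}"
    unfolding disjoint_family_on_def
  proof (intro ballI impI)
    fix i k :: nat assume "i \<in> {1..p}" "k \<in> {1..p}" "i \<noteq> k"
    then have "i \<in> {1..<k} \<or> k \<in> {1..<i}" by auto
    then show "(E i - (\<Union>l\<in>{1..<i}. E l)) \<inter> (E k - (\<Union>l\<in>{1..<k}. E l)) = {}" by blast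
  qed
  moreover have "E i - (\<Union>l\<in>{1..<i}. E l) \<in> sets M" if "i \<in> {1..p}" for i
    using that E by (intro sets.Diff sets.finite_UN) auto
  ultimately show ?thesis
    using finite_measure_finite_Union[of "{1..p}" "\<lambda>i. E i - (\<Union>l\<in>{1..<i}. E l)"]
    by (simp add: image_subset_iff)
qed

text \<open>Only the last inequality differs from the one in \<open>Phi\<close>, and the event of
  equality is null because \<open>c i\<close> is nonzero.\<close>

lemma measure_isotropic_normal_slab_eq_Phi:
  fixes \<mu> :: "real ^ 'q" and c :: "nat \<Rightarrow> real ^ 'q"
  assumes \<sigma>: "\<sigma> > 0" and i: "i \<ge> 1" and ci: "c i \<noteq> 0"
    and \<Sigma>: "\<And>l k. l \<in> {1..i} \<Longrightarrow> k \<in> {1..i} \<Longrightarrow> \<Sigma> l k = c l \<bullet> c k"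
  shows "measure (isotropic_normal \<mu> \<sigma>)
    {v. (\<forall>l\<in>{1..<i}. a l \<le> c l \<bullet> (v - \<mu>) / \<sigma> \<and> c l \<bullet> (v - \<mu>) / \<sigma> \<le> b l) \<and> c i \<bullet> (v - \<mu>) / \<sigma> < r}
    = Phi i a b r \<Sigma>"
proof -
  interpret prob_space "isotropic_normal \<mu> \<sigma>" by (rule prob_space_isotropic_normal[OF \<sigma>])
  have slab: "{v. (\<forall>l\<in>{1..<i}. a l \<le> c l \<bullet> (v - \<mu>) / \<sigma> \<and> c l \<bullet> (v - \<mu>) / \<sigma> \<le> b l)} \<in> sets borel"
    by measurable
  have "{v. c i \<bullet> (v - \<mu>) / \<sigma> < r} \<in> sets borel" "{v. c i \<bullet> (v - \<mu>) / \<sigma> \<le> r} \<in> sets borel"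
    by measurable
  moreover have "Phi i a b r \<Sigma> = prob
      {v. (\<forall>l\<in>{1..<i}. a l \<le> c l \<bullet> (v - \<mu>) / \<sigma> \<and> c l \<bullet> (v - \<mu>) / \<sigma> \<le> b l) \<and> c i \<bullet> (v - \<mu>) / \<sigma> \<le> r}"
    by (rule Phi_eq_measure_isotropic_normal[OF \<sigma> i \<Sigma>])
  ultimately show ?thesis
    using slab AE_isotropic_normal_inner_neq[OF \<sigma> ci, of \<mu> r]
    by (simp only: Collect_conj_eq, intro finite_measure_eq_AE) (auto simp: less_le)
qed

theorem mainTheorem3:
  fixes n m p i\<^sub>0 :: nat
    and \<X> :: "nat set set"
    and M :: "'w measure"
    and X :: "'w \<Rightarrow> nat set"
    and I A :: "'w set"
    and xm x :: "nat set"
    and f :: "nat set \<Rightarrow> real ^ 'q"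
    and \<sigma> \<epsilon> :: real
    and S :: "(real ^ 'q) set"
    and xs :: "nat \<Rightarrow> nat set"
    and \<Delta> :: "nat \<Rightarrow> real"
    and u :: "nat \<Rightarrow> real ^ 'q"
    and \<rho> :: "nat \<Rightarrow> nat \<Rightarrow> real"
    and t :: "nat \<Rightarrow> nat \<Rightarrow> real"
    and \<Sigma> :: "nat \<Rightarrow> nat \<Rightarrow> nat \<Rightarrow> nat \<Rightarrow> real"
  assumes m: "m \<in> {1..n}"
    and \<X>: "\<X> = {y. y \<subseteq> {1..n} \<and> card y = m}"
    and M: "prob_space M"
    and X: "X \<in> measurable M (count_space \<X>)"
    and i\<^sub>0: "i\<^sub>0 \<in> {1..n}"
    and xm: "xm \<subseteq> {1..n} - {i\<^sub>0}" "card xm = m - 1"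
    and I: "I = {\<omega> \<in> space M. i\<^sub>0 \<in> X \<omega>}"
    and A: "A = {\<omega> \<in> space M. xm \<subseteq> X \<omega>}"
    and x: "x \<in> X ` (I \<inter> A)"
    and f: "bounded (f ` \<X>)"
    and \<sigma>: "\<sigma> > 0"
    and \<epsilon>: "\<epsilon> \<ge> 0"
    and S: "S = (\<Union>x' \<in> X ` ((space M - I) \<inter> A). privacy_loss_set f \<sigma> \<epsilon> x x')"
    and xs: "bij_betw xs {1..p} {x' \<in> X ` ((space M - I) \<inter> A). f x' \<noteq> f x}"
    and \<Delta>: "\<And>j. j \<in> {1..p} \<Longrightarrow> \<Delta> j = norm (f x - f (xs j))"
    and u: "\<And>j. j \<in> {1..p} \<Longrightarrow> u j = (1 / \<Delta> j) *\<^sub>R (f x - f (xs j))"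
    and \<rho>: "\<And>j k. j \<in> {1..p} \<Longrightarrow> k \<in> {1..p} \<Longrightarrow> \<rho> j k = u j \<bullet> u k"
    and t1: "\<And>j. j \<in> {1..p} \<Longrightarrow> t j 1 = - (\<epsilon> * \<sigma> / \<Delta> j) - \<Delta> j / (2 * \<sigma>)"
    and t2: "\<And>j. j \<in> {1..p} \<Longrightarrow> t j 2 = \<epsilon> * \<sigma> / \<Delta> j - \<Delta> j / (2 * \<sigma>)"
    and \<Sigma>1: "\<And>i j k. i \<in> {1..p} \<Longrightarrow> j \<in> {1..i} \<Longrightarrow> k \<in> {1..i} \<Longrightarrow> \<Sigma> i 1 j k = \<rho> j k"
    and \<Sigma>2: "\<And>i j k. i \<in> {1..p} \<Longrightarrow> j \<in> {1..i} \<Longrightarrow> k \<in> {1..i} \<Longrightarrow>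
               \<Sigma> i 2 j k = (if j \<noteq> k \<and> (j = i \<or> k = i) then - \<Sigma> i 1 j k else \<Sigma> i 1 j k)"
  shows "measure (gaussian_mechanism f \<sigma> x) S =
         (\<Sum>i=1..p. \<Sum>j=1..2.
            Phi i (\<lambda>l. t l 1) (\<lambda>l. t l 2) ((-1) ^ (j - 1) * t i j) (\<Sigma> i j))"
proof -
  let ?P = "isotropic_normal (f x) \<sigma>"
  interpret P: prob_space ?P by (rule prob_space_isotropic_normal[OF \<sigma>])
  \<comment> \<open>Under \<open>?P\<close> these are the standardized forms with covariances
    \<open>\<rho> j k\<close>, and \<open>E j\<close> is the event that \<open>Y j\<close> leaves
    its interval.\<close>
  define Y where "Y j v = u j \<bullet> (v - f x) / \<sigma>" for j v
  define E where "E j = {v. Y j v < t j 1 \<or> t j 2 < Y j v}" for j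
  have Y [measurable]: "Y j \<in> borel_measurable borel" for j
    unfolding Y_def by measurable
  have xs_ne: "f (xs j) \<noteq> f x" if "j \<in> {1..p}" for j
    using bij_betwE[OF xs] that by blast
  have E_eq: "privacy_loss_set f \<sigma> \<epsilon> x (xs j) = E j" if "j \<in> {1..p}" for j
    using mem_privacy_loss_set_iff[OF \<sigma>, of f "xs j" x _ \<epsilon>] xs_ne[OF that] \<Delta>[OF that] u[OF that] t1[OF that] t2[OF that]
    by (auto simp: E_def Y_def)
  have "S = (\<Union>x' \<in> {x' \<in> X ` ((space M - I) \<inter> A). f x' \<noteq> f x}. privacy_loss_set f \<sigma> \<epsilon> x x')"
    unfolding S using privacy_loss_set_empty[OF \<sigma> \<epsilon>, of f _ x] by fastforce
  also have "\<dots> = (\<Union>j\<in>{1..p}. E j)"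
    unfolding bij_betw_imp_surj_on[OF xs, symmetric] using E_eq by simp
  finally have "measure (gaussian_mechanism f \<sigma> x) S = measure ?P (\<Union>j\<in>{1..p}. E j)"
    by (simp add: gaussian_mechanism_def)
  also have "\<dots> = (\<Sum>i=1..p. measure ?P (E i - (\<Union>l\<in>{1..<i}. E l)))"
    by (rule P.measure_UN_first_entry) (simp add: E_def)
  also have "\<dots> = (\<Sum>i=1..p. \<Sum>j=1..2.
            Phi i (\<lambda>l. t l 1) (\<lambda>l. t l 2) ((-1) ^ (j - 1) * t i j) (\<Sigma> i j))"
  proof (rule sum.cong[OF refl])
    fix i assume i: "i \<in> {1..p}"
    let ?B = "{v. \<forall>l\<in>{1..<i}. t l 1 \<le> Y l v \<and> Y l v \<le> t l 2}"
    \<comment> \<open>Avoiding all earlier \<open>E l\<close> means lying in the slab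
      \<open>?B\<close>; \<open>?D1\<close> and \<open>?D2\<close> are the exits of
      \<open>Y i\<close> below and above.\<close>
    let ?D1 = "?B \<inter> {v. Y i v < t i 1}" and ?D2 = "?B \<inter> {v. t i 2 < Y i v}"
    have B: "?B \<in> sets borel" by measurable
    have "\<Delta> i > 0" using \<Delta>[OF i] xs_ne[OF i] by simp
    \<comment> \<open>Since \<epsilon> is nonnegative the endpoints are ordered, so the two exits
      are disjoint.\<close>
    then have "t i 1 \<le> t i 2" using t1[OF i] t2[OF i] \<epsilon> \<sigma> by simp
    moreover have ui: "u i \<noteq> 0" using u[OF i] xs_ne[OF i] \<open>\<Delta> i > 0\<close> by simp
    ultimately have "measure ?P (E i - (\<Union>l\<in>{1..<i}. E l)) = measure ?P (?D1 \<union> ?D2)"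
      by (intro arg_cong2[where f = measure]) (auto simp: E_def not_less)
    also have "\<dots> = measure ?P ?D1 + measure ?P ?D2"
      using \<open>t i 1 \<le> t i 2\<close> B by (intro P.finite_measure_Union) auto
    also have "measure ?P ?D1 = Phi i (\<lambda>l. t l 1) (\<lambda>l. t l 2) (t i 1) (\<Sigma> i 1)"
      using measure_isotropic_normal_slab_eq_Phi[where c = u and i = i and \<Sigma> = "\<Sigma> i 1" and \<mu> = "f x"
          and a = "\<lambda>l. t l 1" and b = "\<lambda>l. t l 2" and r = "t i 1", OF \<sigma> _ ui] i \<Sigma>1[OF i] \<rho>
      by (simp add: Y_def Collect_conj_eq)
    also have "measure ?P ?D2 = Phi i (\<lambda>l. t l 1) (\<lambda>l. t l 2) (- t i 2) (\<Sigma> i 2)"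
    proof -
      \<comment> \<open>Negating only the last vector turns the upper exit into
        \<open>- Y i v < - t i 2\<close> and leaves the slab unchanged. In the Gram matrix it flips
        the off-diagonal entries of row and column \<open>i\<close>, while the diagonal entry is
        negated twice; this is \<open>\<Sigma> i 2\<close>.\<close>
      let ?c = "u(i := - u i)"
      have "\<Sigma> i 2 l k = ?c l \<bullet> ?c k" if "l \<in> {1..i}" "k \<in> {1..i}" for l k
        using \<Sigma>2[OF i that] \<Sigma>1[OF i that] \<rho>[of l k] that i by auto
      moreover have "?D2 = {v. (\<forall>l\<in>{1..<i}. t l 1 \<le> ?c l \<bullet> (v - f x) / \<sigma> \<and> ?c l \<bullet> (v - f x) / \<sigma> \<le> t l 2)
          \<and> ?c i \<bullet> (v - f x) / \<sigma> < - t i 2}"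
        by (auto simp: Y_def)
      ultimately show ?thesis
        using measure_isotropic_normal_slab_eq_Phi[where c = ?c and i = i and \<Sigma> = "\<Sigma> i 2" and \<mu> = "f x"
          and a = "\<lambda>l. t l 1" and b = "\<lambda>l. t l 2" and r = "- t i 2", OF \<sigma>] i ui
        by simp
    qed
    finally show "measure ?P (E i - (\<Union>l\<in>{1..<i}. E l)) =
        (\<Sum>j=1..2. Phi i (\<lambda>l. t l 1) (\<lambda>l. t l 2) ((-1) ^ (j - 1) * t i j) (\<Sigma> i j))"
      by (simp add: numeral_2_eq_2)
  qed
  finally show ?thesis .
qed

end
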